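(* Let $(G,|\cdot|)$ be a nontrivial complete normed Abelian group. Then $G$ has acyclic nonbranching optimal transport plans if and only if, after rescaling its norm by a positive constant factor, $G$ is isometrically isomorphic to one of the following: - $\mathbb R$ with the Archimedean norm (the usual absolute value); - $\mathbb Z$ with the Archimedean norm; - $\mathbb Z_2$ (with $|1|=1$); - $\mathbb Z_2\times\mathbb Z_2$ with norm satisfying $|(1,0)|=1$, $|(0,1)|=\alpha$, $|(1,1)|=1+\alpha$ for some $\alpha\ge 1$ (any choice of $\alpha\geq 1$ being allowed).
   Context: A normed Abelian group $(G,|\cdot|)$ is an Abelian group $G$ with a function $|\cdot|:G\to\mathbb R_{\ge 0}$ such that $|g+h|\le |g|+|h|$, $|-g|=|g|$ for all $g,h\in G$, and $|g|=0$ if and only if $g=0$. It is complete if it is complete for the metric $(g,h)\mapsto|g-h|$. An isometric isomorphism is a norm-preserving group isomorphism. $\mathbb Z_2=\mathbb Z/2\mathbb Z$. $G$ has acyclic nonbranching optimal transport plans if for every finite collection $g_1,\dots,g_n\in G$ with $\sum_{i=1}^n g_i=0$ there are $g_{ij}\in G$, $i,j=1,\dots,n$, with $g_{ij}=-g_{ji}$, $g_{ii}=0$, $g_i=\sum_{j=1}^n g_{ij}$ and $|g_i|=\sum_{j=1}^n|g_{ij}|$ for all $i,j=1,\dots,n$, and such that the graph with vertex set $\{1,\dots,n\}$ and with an edge $\{i,j\}$ whenever $g_{ij}\neq 0$ contains no cycles. *)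

theory Defs
  imports "HOL-Analysis.Analysis" "HOL-Library.Z2"
begin

section \<open>Normed Abelian groups\<close>

locale normed_ab_group =
  fixes nrm :: "'a::ab_group_add \<Rightarrow> real"
  assumes nrm_nonneg: "0 \<le> nrm g"
    and nrm_triangle: "nrm (g + h) \<le> nrm g + nrm h"
    and nrm_minus: "nrm (- g) = nrm g"
    and nrm_eq_0_iff: "nrm g = 0 \<longleftrightarrow> g = 0"

sublocale normed_ab_group \<subseteq> metric: Metric_space UNIV "\<lambda>g h. nrm (g - h)"
proof
  show "0 \<le> nrm (x - y)" for x y by (rule nrm_nonneg)
  show "nrm (x - y) = nrm (y - x)" for x y
    using nrm_minus [of "x - y"] by simp
  show "(nrm (x - y) = 0) = (x = y)" for x y
    by (simp add: nrm_eq_0_iff)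
  show "nrm (x - z) \<le> nrm (x - y) + nrm (y - z)" for x y z
    using nrm_triangle [of "x - y" "y - z"] by simp
qed

locale complete_normed_ab_group = normed_ab_group nrm
  for nrm :: "'a::ab_group_add \<Rightarrow> real" +
  assumes mcomplete: "metric.mcomplete"

definition isometrically_isomorphic ::
    "('a::ab_group_add \<Rightarrow> real) \<Rightarrow> ('b::ab_group_add \<Rightarrow> real) \<Rightarrow> bool" where
  "isometrically_isomorphic nrm nrm' \<longleftrightarrow>
     (\<exists>\<phi>. bij \<phi> \<and> (\<forall>g h. \<phi> (g + h) = \<phi> g + \<phi> h) \<and> (\<forall>g. nrm' (\<phi> g) = nrm g))"

section \<open>Acyclic nonbranching optimal transport plans\<close>

text \<open>
  Graphs are simple and undirected, with edges given as two-element sets of vertices. A cycle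
  is listed by its pairwise distinct vertices, of which there are at least three, so that
  traversing a single edge back and forth is not a cycle.
\<close>

definition is_cycle :: "'v set \<Rightarrow> 'v set set \<Rightarrow> 'v list \<Rightarrow> bool" where
  "is_cycle V E vs \<longleftrightarrow> 3 \<le> length vs \<and> distinct vs \<and> set vs \<subseteq> V \<and>
     (\<forall>k<length vs. {vs ! k, vs ! (Suc k mod length vs)} \<in> E)"

definition acyclic_graph :: "'v set \<Rightarrow> 'v set set \<Rightarrow> bool" where
  "acyclic_graph V E \<longleftrightarrow> \<not> (\<exists>vs. is_cycle V E vs)"

definition acyclic_nonbranching_plan ::
    "('a::ab_group_add \<Rightarrow> real) \<Rightarrow> nat \<Rightarrow> (nat \<Rightarrow> 'a) \<Rightarrow> (nat \<Rightarrow> nat \<Rightarrow> 'a) \<Rightarrow> bool" where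
  "acyclic_nonbranching_plan nrm n g p \<longleftrightarrow>
     (\<forall>i\<in>{1..n}. \<forall>j\<in>{1..n}. p i j = - p j i) \<and>
     (\<forall>i\<in>{1..n}. p i i = 0) \<and>
     (\<forall>i\<in>{1..n}. g i = (\<Sum>j=1..n. p i j)) \<and>
     (\<forall>i\<in>{1..n}. nrm (g i) = (\<Sum>j=1..n. nrm (p i j))) \<and>
     acyclic_graph {1..n} {{i, j} | i j. i \<in> {1..n} \<and> j \<in> {1..n} \<and> p i j \<noteq> 0}"

definition has_acyclic_nonbranching_plans :: "('a::ab_group_add \<Rightarrow> real) \<Rightarrow> bool" where
  "has_acyclic_nonbranching_plans nrm \<longleftrightarrow>
     (\<forall>n g. (\<Sum>i=1..n. g i) = 0 \<longrightarrow> (\<exists>p. acyclic_nonbranching_plan nrm n g p))"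

section \<open>Norms on \<open>\<int>\<^sub>2\<close> and \<open>\<int>\<^sub>2 \<times> \<int>\<^sub>2\<close>\<close>

text \<open>The type \<^typ>\<open>bit\<close> is the field with two elements; only its additive group is used.\<close>

definition Z2_norm :: "bit \<Rightarrow> real" where
  "Z2_norm x = (if x = 0 then 0 else 1)"

definition Z2xZ2_norm :: "real \<Rightarrow> bit \<times> bit \<Rightarrow> real" where
  "Z2xZ2_norm \<alpha> x =
     (if x = (1, 0) then 1
      else if x = (0, 1) then \<alpha>
      else if x = (1, 1) then 1 + \<alpha>
      else 0)"

lemma normed_ab_group_Z2: "normed_ab_group Z2_norm"
  by unfold_locales (auto simp: Z2_norm_def)

lemma normed_ab_group_Z2xZ2:
  assumes "1 \<le> \<alpha>"
  shows "normed_ab_group (Z2xZ2_norm \<alpha>)"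
proof
  fix g h :: "bit \<times> bit"
  obtain a b c d where gh: "g = (a, b)" "h = (c, d)" by (cases g, cases h)
  show "0 \<le> Z2xZ2_norm \<alpha> g" "Z2xZ2_norm \<alpha> (- g) = Z2xZ2_norm \<alpha> g"
    "Z2xZ2_norm \<alpha> g = 0 \<longleftrightarrow> g = 0"
    using assms unfolding gh
    by (cases a; cases b; simp add: Z2xZ2_norm_def zero_prod_def)+
  show "Z2xZ2_norm \<alpha> (g + h) \<le> Z2xZ2_norm \<alpha> g + Z2xZ2_norm \<alpha> h"
    using assms unfolding gh
    by (cases a; cases b; cases c; cases d; simp add: Z2xZ2_norm_def)
qed

end

theory Submission
  imports Defs
begin

text \<open>
  The existence of plans comes down to a condition on pairs. A forest with an edge has a leaf
  \<open>i\<close>; if \<open>j\<close> is its neighbour, then all of \<open>g i\<close> is sent to \<open>j\<close>, and optimality at \<open>j\<close> says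
  \<open>\<bar>g j\<bar> = \<bar>g i\<bar> + \<bar>g i + g j\<bar>\<close>: the mass \<open>g i\<close> cancels against a part of \<open>g j\<close>. Conversely, if
  every zero-sum family that does not vanish identically has such a pair, then plans are built
  one leaf at a time: \<open>g i\<close> is merged into \<open>g j\<close>, a plan for the rest leaves \<open>i\<close> isolated, and the
  edge from \<open>i\<close> to \<open>j\<close> makes it a leaf. Hence plans exist if and only if the group has cancelling
  pairs (\<open>plans_iff_cancelling_pairs\<close>), and for the four families these are easy to find: numbers of
  opposite sign, equal elements of order two, or two of the three nonzero elements of
  \<open>\<int>\<^sub>2 \<times> \<int>\<^sub>2\<close>.

  For the converse, two kinds of families contain all the information. The family
  \<open>a, b, - (a + b)\<close> shows that of the norms of \<open>a\<close>, \<open>b\<close> and \<open>a + b\<close> one is the sum of the other two,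
  that is, any three points of the group are isometric to three points on a line. The family
  \<open>a, a, a, a\<close> excludes elements of order four. Taking \<open>a = b\<close> in the first condition gives
  \<open>\<bar>2a\<bar> = 2\<bar>a\<bar>\<close> unless \<open>2a = 0\<close>, and the two cases cannot be mixed: if \<open>2a \<noteq> 0\<close>, an element \<open>b\<close> of
  order two would satisfy both \<open>\<bar>b\<bar> = 2\<bar>a\<bar>\<close> and \<open>\<bar>b\<bar> = 2\<bar>2a\<bar>\<close>.

  If \<open>\<bar>2a\<bar> = 2\<bar>a\<bar>\<close> for all \<open>a\<close>, then each element lies on exactly one side of a fixed \<open>a \<noteq> 0\<close>, and
  the norm with the corresponding sign is additive (\<open>signed_add\<close>). The group is thus a subgroup of
  \<open>\<real>\<close>, closed by completeness, hence \<open>\<real>\<close> or a multiple of \<open>\<int>\<close>. If \<open>2a = 0\<close> for all \<open>a\<close>, then the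
  collinearity of triples forbids a third independent element
  (\<open>exponent_two_at_most_four\<close>), which leaves \<open>\<int>\<^sub>2\<close> and \<open>\<int>\<^sub>2 \<times> \<int>\<^sub>2\<close>. The latter is Menger's exceptional
  quadruple, four points that do not embed into a line although any three of them do.
\<close>

section \<open>Leaves of finite forests\<close>

text \<open>
  The first vertex of a longest path is a leaf: any neighbour other than the second vertex
  would either prolong the path or close an initial segment of it to a cycle.
\<close>

lemma acyclic_graph_has_leaf:
  assumes fin: "finite V"
    and acyc: "acyclic_graph V E"
    and edges: "\<And>x y. {x, y} \<in> E \<Longrightarrow> x \<in> V \<and> y \<in> V \<and> x \<noteq> y"
    and edge: "{u, v} \<in> E"
  shows "\<exists>x y. {x, y} \<in> E \<and> (\<forall>w. {x, w} \<in> E \<longrightarrow> w = y)"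
proof (rule ccontr)
  assume no_leaf: "\<not> ?thesis"
  define P where "P vs \<longleftrightarrow> 2 \<le> length vs \<and> distinct vs \<and> set vs \<subseteq> V \<and>
      (\<forall>k. Suc k < length vs \<longrightarrow> {vs ! k, vs ! Suc k} \<in> E)" for vs
  have "P [u, v]"
    using edges[OF edge] edge by (simp add: P_def)
  moreover have "length vs < Suc (card V)" if "P vs" for vs
    using that fin distinct_card[of vs] card_mono[of V "set vs"] by (simp add: P_def)
  ultimately obtain vs where vs: "P vs" and longest: "\<And>ws. P ws \<Longrightarrow> length ws \<le> length vs"
    using ex_has_greatest_nat[of P "[u, v]" length "Suc (card V)"] by blast
  have len: "2 \<le> length vs" and dist: "distinct vs" and sub: "set vs \<subseteq> V"
    and path: "\<And>k. Suc k < length vs \<Longrightarrow> {vs ! k, vs ! Suc k} \<in> E"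
    using vs by (auto simp: P_def)
  have "{vs ! 0, vs ! 1} \<in> E" using path[of 0] len by simp
  with no_leaf obtain w where w: "{vs ! 0, w} \<in> E" "w \<noteq> vs ! 1" by blast
  have wV: "w \<in> V" "w \<noteq> vs ! 0" using edges[OF w(1)] by auto
  show False
  proof (cases "w \<in> set vs")
    case False
    have "P (w # vs)"
      unfolding P_def
    proof (intro conjI allI impI)
      fix k assume "Suc k < length (w # vs)"
      then show "{(w # vs) ! k, (w # vs) ! Suc k} \<in> E"
        using path[of "k - 1"] w(1) by (cases k) (auto simp: insert_commute)
    qed (use len dist sub wV False in auto)
    from longest[OF this] show False by simp
  next
    case True
    then obtain m where m: "m < length vs" "w = vs ! m" by (auto simp: in_set_conv_nth)
    have "m \<noteq> 0" "m \<noteq> 1" using m w(2) wV(2) by metis+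
    then have m2: "2 \<le> m" by simp
    have "is_cycle V E (take (Suc m) vs)"
      unfolding is_cycle_def
    proof (intro conjI allI impI)
      fix k assume "k < length (take (Suc m) vs)"
      then have k: "k \<le> m" using m by simp
      show "{take (Suc m) vs ! k, take (Suc m) vs ! (Suc k mod length (take (Suc m) vs))} \<in> E"
      proof (cases "k = m")
        case True
        moreover have "length (take (Suc m) vs) = Suc m" using m by simp
        ultimately show ?thesis using m w(1) by (simp add: insert_commute)
      next
        case False
        then show ?thesis using m k path[of k] by (simp add: min_def)
      qed
    qed (use m m2 dist sub in \<open>auto dest: in_set_takeD\<close>)
    then show False using acyc by (auto simp: acyclic_graph_def)
  qed
qed

lemma acyclic_graph_add_leaf:
  assumes acyc: "acyclic_graph V E"
    and isolated: "\<And>e. e \<in> E \<Longrightarrow> x \<notin> e"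
    and sub: "E' \<subseteq> insert {x, y} E"
  shows "acyclic_graph V E'"
  unfolding acyclic_graph_def
proof
  assume "\<exists>vs. is_cycle V E' vs"
  then obtain vs where len: "3 \<le> length vs" and dist: "distinct vs" and setV: "set vs \<subseteq> V"
    and cyc: "\<And>k. k < length vs \<Longrightarrow> {vs ! k, vs ! (Suc k mod length vs)} \<in> E'"
    by (auto simp: is_cycle_def)
  let ?n = "length vs"
  have at_x: "b = y" if "{x, b} \<in> E'" for b
    using that sub isolated by (force simp: doubleton_eq_iff)
  show False
  proof (cases "x \<in> set vs")
    case True
    then obtain k where k: "k < ?n" "vs ! k = x" by (auto simp: in_set_conv_nth)
    \<comment> \<open>Both neighbours of \<open>x\<close> on the cycle would be \<open>y\<close>, so the cycle would have length two.\<close>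
    define l where "l = (if k = 0 then ?n - 1 else k - 1)"
    have l: "l < ?n" "Suc l mod ?n = k" using k len by (auto simp: l_def)
    have "vs ! (Suc k mod ?n) = y" using cyc[of k] k at_x by simp
    moreover have "vs ! l = y" using cyc[of l] l k at_x by (simp add: insert_commute)
    moreover have "Suc k mod ?n < ?n" using len by (intro mod_less_divisor) linarith
    ultimately have "Suc k mod ?n = l"
      using dist l nth_eq_iff_index_eq by metis
    then show False using k len by (auto simp: l_def mod_Suc split: if_splits)
  next
    case False
    have "{vs ! k, vs ! (Suc k mod ?n)} \<in> E" if "k < ?n" for k
    proof -
      have "Suc k mod ?n < ?n" using len by (intro mod_less_divisor) linarith
      then have "x \<notin> {vs ! k, vs ! (Suc k mod ?n)}" using False that nth_mem by fastforce
      then show ?thesis using cyc[OF that] sub by blast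
    qed
    then have "is_cycle V E vs" using len dist setV by (auto simp: is_cycle_def)
    then show False using acyc by (auto simp: acyclic_graph_def)
  qed
qed

section \<open>Plans and cancelling pairs\<close>

text \<open>
  In metric terms, \<open>- x\<close> lies between \<open>0\<close> and \<open>y\<close>: no norm is lost if \<open>y\<close> is split into the part
  \<open>- x\<close> and the remainder \<open>x + y\<close>.
\<close>

definition cancels :: "('a::ab_group_add \<Rightarrow> real) \<Rightarrow> 'a \<Rightarrow> 'a \<Rightarrow> bool" where
  "cancels nrm x y \<longleftrightarrow> nrm y = nrm x + nrm (x + y)"

definition has_cancelling_pairs :: "('a::ab_group_add \<Rightarrow> real) \<Rightarrow> bool" where
  "has_cancelling_pairs nrm \<longleftrightarrow>
     (\<forall>(n::nat) g. (\<Sum>i=1..n. g i) = 0 \<longrightarrow> (\<exists>i\<in>{1..n}. g i \<noteq> 0) \<longrightarrow>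
        (\<exists>i\<in>{1..n}. \<exists>j\<in>{1..n}. i \<noteq> j \<and> g i \<noteq> 0 \<and> cancels nrm (g i) (g j)))"

lemma cancelling_pairI:
  "\<lbrakk>i \<in> A; j \<in> A; i \<noteq> j; g i \<noteq> 0; cancels nrm (g i) (g j)\<rbrakk> \<Longrightarrow>
    \<exists>i\<in>A. \<exists>j\<in>A. i \<noteq> j \<and> g i \<noteq> 0 \<and> cancels nrm (g i) (g j)"
  by blast

context normed_ab_group
begin

lemma nrm_0 [simp]: "nrm 0 = 0"
  by (simp add: nrm_eq_0_iff)

lemma nrm_pos: "g \<noteq> 0 \<Longrightarrow> 0 < nrm g"
  using nrm_nonneg[of g] nrm_eq_0_iff[of g] by linarith

lemma nrm_sum_le: "nrm (sum f A) \<le> (\<Sum>i\<in>A. nrm (f i))"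
proof (induction A rule: infinite_finite_induct)
  case (insert x A)
  then show ?case using nrm_triangle[of "f x" "sum f A"] by simp
qed auto

lemma plan_row_zero:
  assumes plan: "acyclic_nonbranching_plan nrm n g p"
    and i: "i \<in> {1..n}" "g i = 0" and k: "k \<in> {1..n}"
  shows "p i k = 0" "p k i = 0"
proof -
  have anti: "p k i = - p i k" and row: "nrm (g i) = (\<Sum>j=1..n. nrm (p i j))"
    using plan i(1) k unfolding acyclic_nonbranching_plan_def by blast+
  have "(\<Sum>j=1..n. nrm (p i j)) = 0" using row i(2) by simp
  then have "\<forall>j\<in>{1..n}. nrm (p i j) = 0"
    by (subst (asm) sum_nonneg_eq_0_iff) (auto simp: nrm_nonneg)
  then show "p i k = 0" using k nrm_eq_0_iff by blast
  then show "p k i = 0" using anti by simp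
qed

text \<open>
  The pair consists of a leaf \<open>i\<close> of the plan and its neighbour \<open>j\<close>. Only \<open>p i j\<close> contributes to
  \<open>g i\<close>, so the entries of row \<open>j\<close> other than \<open>p j i = - g i\<close> add up to \<open>g i + g j\<close>, and the
  optimality of row \<open>j\<close> forces equality in the triangle inequality.
\<close>

lemma plans_imp_cancelling_pairs:
  assumes "has_acyclic_nonbranching_plans nrm"
  shows "has_cancelling_pairs nrm"
  unfolding has_cancelling_pairs_def
proof (intro allI impI)
  fix n :: nat and g :: "nat \<Rightarrow> 'a"
  assume sum0: "(\<Sum>i=1..n. g i) = 0" and "\<exists>i\<in>{1..n}. g i \<noteq> 0"
  then obtain u where u: "u \<in> {1..n}" "g u \<noteq> 0" by blast
  obtain p where "acyclic_nonbranching_plan nrm n g p"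
    using assms sum0 by (auto simp: has_acyclic_nonbranching_plans_def)
  then have anti: "\<And>i j. i \<in> {1..n} \<Longrightarrow> j \<in> {1..n} \<Longrightarrow> p i j = - p j i"
    and diag: "\<And>i. i \<in> {1..n} \<Longrightarrow> p i i = 0"
    and row: "\<And>i. i \<in> {1..n} \<Longrightarrow> g i = (\<Sum>j=1..n. p i j)"
    and row_nrm: "\<And>i. i \<in> {1..n} \<Longrightarrow> nrm (g i) = (\<Sum>j=1..n. nrm (p i j))"
    and acyc: "acyclic_graph {1..n} {{i, j} | i j. i \<in> {1..n} \<and> j \<in> {1..n} \<and> p i j \<noteq> 0}"
    unfolding acyclic_nonbranching_plan_def by blast+
  let ?E = "{{i, j} | i j. i \<in> {1..n} \<and> j \<in> {1..n} \<and> p i j \<noteq> 0}"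
  have E_iff: "{x, y} \<in> ?E \<longleftrightarrow> x \<in> {1..n} \<and> y \<in> {1..n} \<and> p x y \<noteq> 0" for x y
    using anti[of x y] by (auto simp: doubleton_eq_iff)
  obtain v where "v \<in> {1..n}" "p u v \<noteq> 0"
    using u row[OF u(1)] by (metis sum.neutral)
  with u have "{u, v} \<in> ?E" unfolding E_iff by blast
  then obtain i j where ij: "{i, j} \<in> ?E" and leaf: "\<And>w. {i, w} \<in> ?E \<Longrightarrow> w = j"
    using acyclic_graph_has_leaf[OF _ acyc, of u v] diag unfolding E_iff by blast
  have i: "i \<in> {1..n}" and j: "j \<in> {1..n}" and pij: "p i j \<noteq> 0" "i \<noteq> j"
    using ij diag unfolding E_iff by auto
  have "p i k = 0" if "k \<in> {1..n} - {j}" for k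
    using leaf[of k] i that unfolding E_iff by blast
  then have gi: "g i = p i j"
    unfolding row[OF i] sum.remove[OF finite_atLeastAtMost j] by simp
  have pji: "p j i = - g i" using anti[OF j i] gi by simp
  have "g i + g j = (\<Sum>k\<in>{1..n} - {i}. p j k)"
    unfolding row[OF j] sum.remove[OF finite_atLeastAtMost i, of "p j"] pji by simp
  moreover have "nrm (g j) = nrm (g i) + (\<Sum>k\<in>{1..n} - {i}. nrm (p j k))"
    unfolding row_nrm[OF j] sum.remove[OF finite_atLeastAtMost i, of "\<lambda>k. nrm (p j k)"] pji
    by (simp add: nrm_minus)
  ultimately have "nrm (g i) + nrm (g i + g j) \<le> nrm (g j)"
    using nrm_sum_le[of "p j" "{1..n} - {i}"] by simp
  moreover have "nrm (g j) \<le> nrm (g i) + nrm (g i + g j)"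
    using nrm_triangle[of "- g i" "g i + g j"] by (simp add: nrm_minus)
  ultimately have "cancels nrm (g i) (g j)" by (simp add: cancels_def)
  then show "\<exists>i\<in>{1..n}. \<exists>j\<in>{1..n}. i \<noteq> j \<and> g i \<noteq> 0 \<and> cancels nrm (g i) (g j)"
    using i j pij by (metis gi)
qed

text \<open>
  In a plan for the merged family the vertex \<open>i\<close> carries no mass, so it is isolated and the
  new edge cannot close a cycle.
\<close>

lemma plan_extend_by_leaf:
  assumes plan: "acyclic_nonbranching_plan nrm n (g(i := 0, j := g i + g j)) p'"
    and i: "i \<in> {1..n}" and j: "j \<in> {1..n}" and "i \<noteq> j"
    and canc: "cancels nrm (g i) (g j)"
  shows "\<exists>p. acyclic_nonbranching_plan nrm n g p"
proof -
  define p where "p k l = (if k = i \<and> l = j then g i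
      else if k = j \<and> l = i then - g i else p' k l)" for k l
  let ?g' = "g(i := 0, j := g i + g j)"
  let ?E' = "{{k, l} | k l. k \<in> {1..n} \<and> l \<in> {1..n} \<and> p' k l \<noteq> 0}"
  have zero: "p' i k = 0" "p' k i = 0" if "k \<in> {1..n}" for k
    using plan_row_zero[OF plan i _ that] \<open>i \<noteq> j\<close> by auto
  have anti': "\<And>k l. k \<in> {1..n} \<Longrightarrow> l \<in> {1..n} \<Longrightarrow> p' k l = - p' l k"
    and diag': "\<And>k. k \<in> {1..n} \<Longrightarrow> p' k k = 0"
    and row': "\<And>k. k \<in> {1..n} \<Longrightarrow> ?g' k = (\<Sum>l=1..n. p' k l)"
    and row_nrm': "\<And>k. k \<in> {1..n} \<Longrightarrow> nrm (?g' k) = (\<Sum>l=1..n. nrm (p' k l))"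
    and acyc: "acyclic_graph {1..n} ?E'"
    using plan unfolding acyclic_nonbranching_plan_def by blast+
  have row: "g k = (\<Sum>l=1..n. p k l) \<and> nrm (g k) = (\<Sum>l=1..n. nrm (p k l))"
    if k: "k \<in> {1..n}" for k
  proof -
    consider "k = i" | "k = j" | "k \<noteq> i" "k \<noteq> j" by blast
    then show ?thesis
    proof cases
      case 1
      have "(\<Sum>l=1..n. p i l) = (\<Sum>l=1..n. if l = j then g i else 0)"
        and "(\<Sum>l=1..n. nrm (p i l)) = (\<Sum>l=1..n. if l = j then nrm (g i) else 0)"
        by (rule sum.cong; use zero \<open>i \<noteq> j\<close> in \<open>simp add: p_def\<close>)+
      then show ?thesis using 1 j by simp
    next
      case 2
      have "(\<Sum>l=1..n. p j l) = (\<Sum>l=1..n. p' j l + (if l = i then - g i else 0))"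
        and "(\<Sum>l=1..n. nrm (p j l)) = (\<Sum>l=1..n. nrm (p' j l) + (if l = i then nrm (g i) else 0))"
        by (rule sum.cong; use zero j \<open>i \<noteq> j\<close> in \<open>simp add: p_def nrm_minus\<close>)+
      then show ?thesis
        using 2 i row'[OF j, symmetric] row_nrm'[OF j, symmetric] canc \<open>i \<noteq> j\<close>
        by (simp add: sum.distrib cancels_def)
    next
      case 3
      then have "p k = p' k" by (auto simp: p_def fun_eq_iff)
      then show ?thesis using 3 row'[OF k] row_nrm'[OF k] by simp
    qed
  qed
  have acyc_p: "acyclic_graph {1..n} {{k, l} | k l. k \<in> {1..n} \<and> l \<in> {1..n} \<and> p k l \<noteq> 0}"
  proof (rule acyclic_graph_add_leaf[OF acyc, where x = i and y = j])
    show "i \<notin> e" if "e \<in> ?E'" for e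
      using that zero by blast
    show "{{k, l} | k l. k \<in> {1..n} \<and> l \<in> {1..n} \<and> p k l \<noteq> 0} \<subseteq> insert {i, j} ?E'"
    proof
      fix e assume "e \<in> {{k, l} | k l. k \<in> {1..n} \<and> l \<in> {1..n} \<and> p k l \<noteq> 0}"
      then obtain k l where e: "e = {k, l}" "k \<in> {1..n}" "l \<in> {1..n}" "p k l \<noteq> 0" by blast
      then show "e \<in> insert {i, j} ?E'"
        by (cases "e = {i, j}") (auto simp: p_def split: if_splits)
    qed
  qed
  have anti: "p k l = - p l k" if "k \<in> {1..n}" "l \<in> {1..n}" for k l
    using anti'[OF that] \<open>i \<noteq> j\<close> by (simp add: p_def)
  have diag: "p k k = 0" if "k \<in> {1..n}" for k
    using diag'[OF that] \<open>i \<noteq> j\<close> by (auto simp: p_def)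
  have "acyclic_nonbranching_plan nrm n g p"
    unfolding acyclic_nonbranching_plan_def
    by (intro conjI ballI acyc_p)
      (rule anti diag row[THEN conjunct1] row[THEN conjunct2]; assumption)+
  then show ?thesis by blast
qed

lemma cancelling_pairs_imp_plans:
  assumes canc: "has_cancelling_pairs nrm"
  shows "has_acyclic_nonbranching_plans nrm"
  unfolding has_acyclic_nonbranching_plans_def
proof (intro allI impI)
  fix n :: nat and g :: "nat \<Rightarrow> 'a"
  assume "(\<Sum>i=1..n. g i) = 0"
  then show "\<exists>p. acyclic_nonbranching_plan nrm n g p"
  proof (induction g rule: measure_induct_rule[of "\<lambda>g. card {i \<in> {1..n}. g i \<noteq> 0}"])
    case (less g)
    show ?case
    proof (cases "\<exists>i\<in>{1..n}. g i \<noteq> 0")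
      case False
      have "\<not> is_cycle {1..n} {} vs" for vs :: "nat list"
      proof
        assume "is_cycle {1..n} {} vs"
        then have "3 \<le> length vs" "\<forall>k<length vs. False" by (simp_all add: is_cycle_def)
        then show False by (metis less_le_trans zero_less_numeral)
      qed
      then have "acyclic_nonbranching_plan nrm n g (\<lambda>_ _. 0)"
        using False by (simp add: acyclic_nonbranching_plan_def acyclic_graph_def)
      then show ?thesis by blast
    next
      case True
      then obtain i j where i: "i \<in> {1..n}" and j: "j \<in> {1..n}" and ij: "i \<noteq> j" "g i \<noteq> 0"
        and c: "cancels nrm (g i) (g j)"
        using canc[unfolded has_cancelling_pairs_def, rule_format, OF less.prems] by blast
      let ?g' = "g(i := 0, j := g i + g j)"
      have "0 < nrm (g j)"
        using c nrm_pos[OF ij(2)] nrm_nonneg[of "g i + g j"] by (simp add: cancels_def)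
      then have "g j \<noteq> 0" by auto
      then have "{k \<in> {1..n}. ?g' k \<noteq> 0} \<subset> {k \<in> {1..n}. g k \<noteq> 0}"
        using i ij by auto
      then have "card {k \<in> {1..n}. ?g' k \<noteq> 0} < card {k \<in> {1..n}. g k \<noteq> 0}"
        by (rule psubset_card_mono[rotated]) simp
      moreover have "(\<Sum>k=1..n. ?g' k) = 0"
      proof -
        have "(\<Sum>k=1..n. ?g' k)
            = (\<Sum>k=1..n. g k + ((if k = i then - g i else 0) + (if k = j then g i else 0)))"
          using ij by (intro sum.cong) auto
        also have "\<dots> = 0" using less.prems i j by (simp add: sum.distrib)
        finally show ?thesis .
      qed
      ultimately obtain p' where "acyclic_nonbranching_plan nrm n ?g' p'"
        using less.IH[of ?g'] by blast
      then show ?thesis by (rule plan_extend_by_leaf[OF _ i j ij(1) c])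
    qed
  qed
qed

theorem plans_iff_cancelling_pairs:
  "has_acyclic_nonbranching_plans nrm \<longleftrightarrow> has_cancelling_pairs nrm"
  using plans_imp_cancelling_pairs cancelling_pairs_imp_plans by blast

end

section \<open>The four families have cancelling pairs\<close>

lemma real_zero_sum_opposite_signs:
  fixes f :: "'i \<Rightarrow> real"
  assumes "finite A" "sum f A = 0" "k \<in> A" "f k \<noteq> 0"
  shows "\<exists>i\<in>A. \<exists>j\<in>A. f i < 0 \<and> 0 < f j"
proof (rule ccontr)
  assume "\<not> ?thesis"
  then have "(\<forall>i\<in>A. 0 \<le> f i) \<or> (\<forall>i\<in>A. 0 \<le> - f i)" by force
  then show False
  proof
    assume "\<forall>i\<in>A. 0 \<le> f i"
    then show False using assms sum_nonneg_eq_0_iff[of A f] by blast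
  next
    assume "\<forall>i\<in>A. 0 \<le> - f i"
    moreover have "(\<Sum>i\<in>A. - f i) = 0" using assms(2) by (simp add: sum_negf)
    ultimately have "- f k = 0" using assms sum_nonneg_eq_0_iff[of A "\<lambda>i. - f i"] by blast
    then show False using assms(4) by simp
  qed
qed

context normed_ab_group
begin

text \<open>
  Among two numbers of opposite sign, the one of smaller absolute value cancels against the
  other. The scaled isometry \<open>\<phi>\<close> may be into, so that this serves \<open>\<int>\<close> as well as \<open>\<real>\<close>.
\<close>

lemma cancelling_pairs_if_embeds_in_reals:
  assumes add: "\<And>g h. \<phi> (g + h) = \<phi> g + \<phi> h"
    and nrm: "\<And>g. \<bar>\<phi> g\<bar> = c * nrm g" and c: "0 < c"
  shows "has_cancelling_pairs nrm"
  unfolding has_cancelling_pairs_def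
proof (intro allI impI)
  fix n :: nat and g :: "nat \<Rightarrow> 'a"
  assume sum0: "(\<Sum>i=1..n. g i) = 0" and "\<exists>i\<in>{1..n}. g i \<noteq> 0"
  then obtain k where k: "k \<in> {1..n}" "g k \<noteq> 0" by blast
  have nz: "\<phi> x = 0 \<longleftrightarrow> x = 0" for x
    using nrm[of x] c nrm_eq_0_iff[of x] by auto
  have "\<phi> (sum g A) = (\<Sum>i\<in>A. \<phi> (g i))" if "finite A" for A
    using that nz[of 0] by induction (auto simp: add)
  then have "(\<Sum>i=1..n. \<phi> (g i)) = 0" using sum0 nz by (metis finite_atLeastAtMost)
  then obtain i j where ij: "i \<in> {1..n}" "j \<in> {1..n}" "\<phi> (g i) < 0" "0 < \<phi> (g j)"
    using real_zero_sum_opposite_signs[of "{1..n}" "\<lambda>i. \<phi> (g i)" k] k nz by auto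
  have canc: "cancels nrm x y" if "\<bar>\<phi> y\<bar> = \<bar>\<phi> x\<bar> + \<bar>\<phi> x + \<phi> y\<bar>" for x y
  proof -
    have "c * nrm y = c * (nrm x + nrm (x + y))"
      using that by (simp add: add[symmetric] nrm distrib_left)
    then show ?thesis using c by (simp add: cancels_def)
  qed
  have "i \<noteq> j" "g i \<noteq> 0" "g j \<noteq> 0" using ij(3,4) nz[of "g i"] nz[of "g j"] by auto
  note distinct_nz = this
  have "cancels nrm (g i) (g j) \<or> cancels nrm (g j) (g i)"
    using ij(3,4) canc[of "g i" "g j"] canc[of "g j" "g i"] by linarith
  then show "\<exists>i\<in>{1..n}. \<exists>j\<in>{1..n}. i \<noteq> j \<and> g i \<noteq> 0 \<and> cancels nrm (g i) (g j)"
  proof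
    assume "cancels nrm (g i) (g j)"
    then show ?thesis using ij(1,2) distinct_nz
      by (intro cancelling_pairI[of i _ j]) auto
  next
    assume "cancels nrm (g j) (g i)"
    then show ?thesis using ij(1,2) distinct_nz
      by (intro cancelling_pairI[of j _ i]) auto
  qed
qed

lemma cancelling_pairs_if_isomorphic:
  assumes iso: "isometrically_isomorphic (\<lambda>g. c * nrm g) nrm'" and c: "0 < c"
    and canc: "has_cancelling_pairs nrm'"
  shows "has_cancelling_pairs nrm"
  unfolding has_cancelling_pairs_def
proof (intro allI impI)
  fix n :: nat and g :: "nat \<Rightarrow> 'a"
  assume sum0: "(\<Sum>i=1..n. g i) = 0" and ex: "\<exists>i\<in>{1..n}. g i \<noteq> 0"
  obtain \<phi> where bij: "bij \<phi>" and add: "\<And>x y. \<phi> (x + y) = \<phi> x + \<phi> y"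
    and nrm: "\<And>x. nrm' (\<phi> x) = c * nrm x"
    using iso unfolding isometrically_isomorphic_def by blast
  have "\<phi> 0 = 0" using add[of 0 0] by simp
  then have nz: "\<phi> x = 0 \<longleftrightarrow> x = 0" for x
    using inj_eq[OF bij_is_inj[OF bij], of x 0] by simp
  have "\<phi> (sum g A) = (\<Sum>i\<in>A. \<phi> (g i))" if "finite A" for A
    using that \<open>\<phi> 0 = 0\<close> by induction (auto simp: add)
  then have "(\<Sum>i=1..n. \<phi> (g i)) = 0" using sum0 nz by (metis finite_atLeastAtMost)
  moreover have "\<exists>i\<in>{1..n}. \<phi> (g i) \<noteq> 0" using ex nz by blast
  ultimately obtain i j where ij: "i \<in> {1..n}" "j \<in> {1..n}" "i \<noteq> j" "\<phi> (g i) \<noteq> 0"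
    "cancels nrm' (\<phi> (g i)) (\<phi> (g j))"
    using canc[unfolded has_cancelling_pairs_def, rule_format, of "\<lambda>i. \<phi> (g i)" n] by auto
  have "c * nrm (g j) = c * (nrm (g i) + nrm (g i + g j))"
    using ij(5) by (simp add: cancels_def add[symmetric] nrm distrib_left)
  then have "cancels nrm (g i) (g j)" using c by (simp add: cancels_def)
  then show "\<exists>i\<in>{1..n}. \<exists>j\<in>{1..n}. i \<noteq> j \<and> g i \<noteq> 0 \<and> cancels nrm (g i) (g j)"
    using ij nz by blast
qed

text \<open>
  Two equal elements of order two cancel each other, whatever the norm. So only families without
  repetitions remain, and these are just finite sets.
\<close>

lemma cancelling_pairs_if_exponent_two:
  assumes two: "\<And>x::'a. x + x = 0"
    and distinct: "\<And>S. finite S \<Longrightarrow> S \<noteq> {} \<Longrightarrow> 0 \<notin> S \<Longrightarrow> \<Sum>S = 0 \<Longrightarrow>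
      \<exists>x\<in>S. \<exists>y\<in>S. x \<noteq> y \<and> cancels nrm x y"
  shows "has_cancelling_pairs nrm"
  unfolding has_cancelling_pairs_def
proof (intro allI impI)
  fix n :: nat and g :: "nat \<Rightarrow> 'a"
  assume sum0: "(\<Sum>i=1..n. g i) = 0" and ex: "\<exists>i\<in>{1..n}. g i \<noteq> 0"
  let ?I = "{i \<in> {1..n}. g i \<noteq> 0}"
  show "\<exists>i\<in>{1..n}. \<exists>j\<in>{1..n}. i \<noteq> j \<and> g i \<noteq> 0 \<and> cancels nrm (g i) (g j)"
  proof (cases "inj_on g ?I")
    case True
    have "(\<Sum>i\<in>?I. g i) = (\<Sum>i=1..n. g i)"
      by (rule sum.mono_neutral_left) auto
    with True sum0 have "\<Sum>(g ` ?I) = 0" by (simp add: sum.reindex)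
    moreover have "g ` ?I \<noteq> {}" "0 \<notin> g ` ?I" using ex by auto
    ultimately have "\<exists>x\<in>g ` ?I. \<exists>y\<in>g ` ?I. x \<noteq> y \<and> cancels nrm x y"
      by (intro distinct) simp_all
    then obtain x y where xy: "x \<in> g ` ?I" "y \<in> g ` ?I" "x \<noteq> y" "cancels nrm x y" by blast
    from xy(1) obtain i where "i \<in> {1..n}" "g i \<noteq> 0" "x = g i" by blast
    moreover from xy(2) obtain j where "j \<in> {1..n}" "y = g j" by blast
    ultimately show ?thesis using xy(3,4)
      by (intro cancelling_pairI[of i _ j]) auto
  next
    case False
    then obtain i j where "i \<in> {1..n}" "j \<in> {1..n}" "i \<noteq> j" "g i \<noteq> 0" "g i = g j"
      unfolding inj_on_def by blast
    moreover from this have "cancels nrm (g i) (g j)" using two by (simp add: cancels_def)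
    ultimately show ?thesis
      by (intro cancelling_pairI[of i _ j]) auto
  qed
qed

end

lemma bit_pair_cases: "x \<in> {(0, 0), (1, 0), (0, 1), (1 :: bit, 1 :: bit)}"
proof -
  obtain p q :: bit where "x = (p, q)" by (cases x)
  then show ?thesis by (cases p; cases q) auto
qed

lemma bit_pair_exponent_two: "x + x = (0 :: bit \<times> bit)"
  by (cases x) (simp add: zero_prod_def)

lemma cancelling_pairs_Z2: "has_cancelling_pairs Z2_norm"
proof (rule normed_ab_group.cancelling_pairs_if_exponent_two[OF normed_ab_group_Z2])
  fix S :: "bit set"
  assume "S \<noteq> {}" "0 \<notin> S" "\<Sum>S = 0"
  have "S \<subseteq> {1}"
  proof
    fix x assume "x \<in> S"
    with \<open>0 \<notin> S\<close> show "x \<in> {1}" by (cases x) auto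
  qed
  with \<open>S \<noteq> {}\<close> have "S = {1}" by blast
  with \<open>\<Sum>S = 0\<close> show "\<exists>x\<in>S. \<exists>y\<in>S. x \<noteq> y \<and> cancels Z2_norm x y" by simp
qed simp

lemma cancelling_pairs_Z2xZ2:
  assumes "1 \<le> \<alpha>"
  shows "has_cancelling_pairs (Z2xZ2_norm \<alpha>)"
proof (rule normed_ab_group.cancelling_pairs_if_exponent_two[OF normed_ab_group_Z2xZ2[OF assms]])
  fix S :: "(bit \<times> bit) set"
  assume S: "S \<noteq> {}" "0 \<notin> S" "\<Sum>S = 0"
  have "x \<in> {(1, 0), (0, 1), (1, 1)}" if "x \<in> S" for x
    using that S(2) bit_pair_cases[of x] by (auto simp: zero_prod_def)
  then have "S \<in> Pow {(1, 0), (0, 1), (1, 1)}" by blast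
  then have "S = {(1, 0), (0, 1), (1, 1)}"
    using S by (auto simp: Pow_insert zero_prod_def)
  moreover have "cancels (Z2xZ2_norm \<alpha>) (1, 0) (1, 1)"
    by (simp add: cancels_def Z2xZ2_norm_def)
  ultimately show "\<exists>x\<in>S. \<exists>y\<in>S. x \<noteq> y \<and> cancels (Z2xZ2_norm \<alpha>) x y" by auto
qed (rule bit_pair_exponent_two)

section \<open>Triples of points are collinear\<close>

locale collinear_normed_group = normed_ab_group nrm
  for nrm :: "'a::ab_group_add \<Rightarrow> real" +
  assumes collinear: "nrm (a + b) = nrm a + nrm b \<or> nrm (a + b) = \<bar>nrm a - nrm b\<bar>"
    and no_order_4: "a + a + (a + a) = 0 \<Longrightarrow> a + a = (0::'a)"

text \<open>
  Collinearity is the existence of a cancelling pair for \<open>a, b, - (a + b)\<close>: whichever two elements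
  cancel, one of the three norms is the sum of the others. In the family \<open>a, a, a, a\<close> a cancelling
  pair means \<open>\<bar>a\<bar> = \<bar>a\<bar> + \<bar>2a\<bar>\<close>.
\<close>

lemma (in normed_ab_group) collinear_if_cancelling_pairs:
  assumes canc: "has_cancelling_pairs nrm"
  shows "collinear_normed_group nrm"
proof
  fix a b
  show "nrm (a + b) = nrm a + nrm b \<or> nrm (a + b) = \<bar>nrm a - nrm b\<bar>"
  proof (cases "a = 0 \<or> b = 0")
    case True
    then show ?thesis by auto
  next
    case False
    define g where "g i = (if i = 1 then a else if i = 2 then b else - (a + b))" for i :: nat
    have three: "{1..3} = {1, 2, 3::nat}" by auto
    have vals: "g 1 = a" "g 2 = b" "g 3 = - (a + b)" by (auto simp: g_def)
    have "(\<Sum>i=1..3. g i) = 0" "\<exists>i\<in>{1..3}. g i \<noteq> 0"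
      using False vals unfolding three by auto
    then have "\<exists>i\<in>{1..3}. \<exists>j\<in>{1..3}. i \<noteq> j \<and> g i \<noteq> 0 \<and> cancels nrm (g i) (g j)"
      using canc unfolding has_cancelling_pairs_def by blast
    moreover have "nrm (- a - b) = nrm (a + b)"
      using nrm_minus[of "a + b"] by (simp add: algebra_simps)
    ultimately have "nrm a = nrm b + nrm (a + b) \<or> nrm b = nrm a + nrm (a + b) \<or>
        nrm (a + b) = nrm a + nrm b"
      unfolding three by (auto simp: vals cancels_def nrm_minus add.commute simp del: One_nat_def)
    then show ?thesis using nrm_nonneg[of "a + b"] by linarith
  qed
next
  fix a :: 'a
  assume four: "a + a + (a + a) = 0"
  show "a + a = 0"
  proof (rule ccontr)
    assume nz: "a + a \<noteq> 0"
    have "{1..4} = {1, 2, 3, 4::nat}" by auto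
    then have "(\<Sum>i=1..(4::nat). a) = 0" using four by (simp add: add.assoc)
    moreover have "\<exists>i\<in>{1..(4::nat)}. a \<noteq> 0" using nz by auto
    ultimately have "cancels nrm a a"
      using canc[unfolded has_cancelling_pairs_def, rule_format, of "\<lambda>_. a" 4] by blast
    then show False using nz by (simp add: cancels_def nrm_eq_0_iff)
  qed
qed

context collinear_normed_group
begin

lemma nrm_double: "a + a \<noteq> 0 \<Longrightarrow> nrm (a + a) = 2 * nrm a"
  using collinear[of a a] by (auto simp: nrm_eq_0_iff)

text \<open>
  If \<open>b\<close> has order two and \<open>x\<close> does not, then \<open>2(x + b) = 2x\<close>, so \<open>x + b\<close> and \<open>x\<close> have the same norm
  and collinearity leaves only \<open>\<bar>b\<bar> = 2\<bar>x\<bar>\<close>. This cannot hold for both \<open>x = a\<close> and \<open>x = 2a\<close>, where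
  the latter does not have order two because there are no elements of order four.
\<close>

lemma doubling_if_not_exponent_two:
  fixes a :: 'a
  assumes "a + a \<noteq> 0"
  shows "nrm (b + b) = 2 * nrm b"
proof (cases "b + b = 0")
  case True
  have b: "b = 0 \<or> nrm b = 2 * nrm x" if x: "x + x \<noteq> 0" for x
  proof -
    have "(x + b) + (x + b) = x + x" using True by (simp add: algebra_simps)
    then have "nrm (x + b) = nrm x"
      using nrm_double[of "x + b"] nrm_double[OF x] x by (metis mult_left_cancel zero_neq_numeral)
    then show ?thesis
      using collinear[of x b] nrm_nonneg[of b] by (auto simp: nrm_eq_0_iff abs_if split: if_splits)
  qed
  have "a + a + (a + a) \<noteq> 0" using assms no_order_4[of a] by argo
  then have "b = 0"
    using b[OF assms] b[of "a + a"] nrm_double[OF assms] nrm_pos[OF assms] by auto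
  then show ?thesis by simp
qed (rule nrm_double)

end

section \<open>Groups without two-torsion embed into the reals\<close>

locale doubling_normed_group = collinear_normed_group nrm
  for nrm :: "'a::ab_group_add \<Rightarrow> real" +
  assumes doubling: "nrm (a + a) = 2 * nrm a"
begin

text \<open>
  The signed norm of \<open>b\<close>, where the side of \<open>a\<close> counts as positive.
\<close>

definition signed :: "'a \<Rightarrow> 'a \<Rightarrow> real" where
  "signed a b = (if nrm (a + b) = nrm a + nrm b then nrm b else - nrm b)"

lemma abs_signed: "\<bar>signed a b\<bar> = nrm b"
  by (simp add: signed_def nrm_nonneg)

text \<open>
  Both \<open>2a\<close> and \<open>2b\<close> are, up to sign, sums of \<open>a + b\<close> and \<open>a - b\<close>. Were the norms of these both
  \<open>\<bar>a\<bar> + \<bar>b\<bar>\<close>, collinearity would make \<open>\<bar>2a\<bar>\<close> too large or zero; were they both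
  \<open>\<bar>\<bar>a\<bar> - \<bar>b\<bar>\<bar>\<close>, then \<open>\<bar>a\<bar>\<close> and \<open>\<bar>b\<bar>\<close> would both equal this difference.
\<close>

lemma exactly_one_side:
  assumes "a \<noteq> 0" "b \<noteq> 0"
  shows "nrm (a - b) = nrm a + nrm b \<longleftrightarrow> nrm (a + b) \<noteq> nrm a + nrm b"
proof -
  have "(a + b) + (a - b) = a + a" "(a + b) + - (a - b) = b + b" by (simp_all add: algebra_simps)
  then have "2 * nrm a = nrm (a + b) + nrm (a - b) \<or> 2 * nrm a = \<bar>nrm (a + b) - nrm (a - b)\<bar>"
    "2 * nrm b = nrm (a + b) + nrm (a - b) \<or> 2 * nrm b = \<bar>nrm (a + b) - nrm (a - b)\<bar>"
    using collinear[of "a + b" "a - b"] collinear[of "a + b" "- (a - b)"]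
    by (metis doubling nrm_minus)+
  moreover have "nrm (a - b) = nrm a + nrm b \<or> nrm (a - b) = \<bar>nrm a - nrm b\<bar>"
    using collinear[of a "- b"] by (simp add: nrm_minus)
  ultimately show ?thesis
    using collinear[of a b] nrm_pos[OF assms(1)] nrm_pos[OF assms(2)]
    by (smt (verit))
qed

lemma signed_minus:
  assumes "a \<noteq> 0"
  shows "signed a (- b) = - signed a b"
  using exactly_one_side[OF assms, of b] by (cases "b = 0") (auto simp: signed_def nrm_minus)

lemma nrm_add_eq_signed:
  assumes "nrm b \<le> nrm a"
  shows "nrm (a + b) = nrm a + signed a b"
  using collinear[of a b] assms by (auto simp: signed_def)

lemma signed_double:
  assumes "a \<noteq> 0"
  shows "signed (a + a) b = signed a b"
proof (cases "b = 0")
  case False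
  have aa: "a + a \<noteq> 0" using doubling[of a] nrm_pos[OF assms] by auto
  \<comment> \<open>If \<open>c\<close> lies on the side of \<open>a\<close>, then \<open>- c\<close> is too close to \<open>2a\<close> to lie on its side.\<close>
  have pos: "nrm (a + a + c) = nrm (a + a) + nrm c"
    if c: "c \<noteq> 0" "nrm (a + c) = nrm a + nrm c" for c
  proof -
    have "nrm (a - c) = \<bar>nrm a - nrm c\<bar>"
      using collinear[of a "- c"] exactly_one_side[OF assms c(1)] c(2) by (auto simp: nrm_minus)
    moreover have "nrm (a + a - c) \<le> nrm a + nrm (a - c)"
      using nrm_triangle[of a "a - c"] by (simp add: algebra_simps)
    ultimately have "nrm (a + a - c) \<noteq> nrm (a + a) + nrm c"
      using doubling[of a] nrm_pos[OF c(1)] nrm_pos[OF assms] by auto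
    then show ?thesis using exactly_one_side[OF aa c(1)] by blast
  qed
  show ?thesis
    using pos[of b] pos[of "- b"] exactly_one_side[OF assms False] exactly_one_side[OF aa False] False
    by (auto simp: signed_def nrm_minus)
qed (simp add: signed_def)

text \<open>
  The sign does not change if \<open>a\<close> is replaced by \<open>d = 2\<^sup>k a\<close>. For \<open>d\<close> far away,
  the signed norm of \<open>x\<close> is \<open>\<bar>d + x\<bar> - \<bar>d\<bar>\<close>, a Busemann function in direction \<open>a\<close>, and the
  triangle inequality for \<open>2d + (x + y) = (d + x) + (d + y)\<close> makes it subadditive. Since it is
  also odd, it is additive.
\<close>

lemma signed_add:
  assumes "a \<noteq> 0"
  shows "signed a (b + c) = signed a b + signed a c"
proof -
  define d where "d k = ((\<lambda>x. x + x) ^^ k) a" for k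
  have nrm_d: "nrm (d k) = 2 ^ k * nrm a" for k
    by (induction k) (simp_all add: d_def doubling)
  have d0: "d k \<noteq> 0" for k
    using nrm_d[of k] nrm_pos[OF assms] by auto
  have signed_d: "signed (d k) x = signed a x" for k x
  proof (induction k)
    case (Suc k)
    then show ?case using signed_double[OF d0[of k]] by (simp add: d_def)
  qed (simp add: d_def)
  have le: "signed a (x + y) \<le> signed a x + signed a y" for x y
  proof -
    obtain k where "(nrm x + nrm y) / nrm a < 2 ^ k"
      using real_arch_pow[of 2] by auto
    then have "nrm x + nrm y < nrm (d k)"
      using nrm_pos[OF assms] by (simp add: nrm_d pos_divide_less_eq)
    then have "nrm x \<le> nrm (d k)" "nrm y \<le> nrm (d k)" "nrm (x + y) \<le> nrm (d k + d k)"
      using nrm_nonneg[of x] nrm_nonneg[of y] nrm_triangle[of x y] doubling[of "d k"] by linarith+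
    then have "nrm (d k + x) = nrm (d k) + signed a x" "nrm (d k + y) = nrm (d k) + signed a y"
      "nrm (d k + d k + (x + y)) = nrm (d k + d k) + signed a (x + y)"
      using nrm_add_eq_signed signed_d signed_double[OF d0] by metis+
    moreover have "nrm (d k + d k + (x + y)) \<le> nrm (d k + x) + nrm (d k + y)"
      using nrm_triangle[of "d k + x" "d k + y"] by (simp add: algebra_simps)
    ultimately show ?thesis using doubling[of "d k"] by simp
  qed
  have "signed a (- (b + c)) \<le> signed a (- b) + signed a (- c)"
    using le[of "- b" "- c"] by (simp add: algebra_simps)
  with le[of b c] show ?thesis by (simp only: signed_minus[OF assms])
qed

end

section \<open>Closed subgroups of the real line\<close>

text \<open>
  Everything depends on the infimum \<open>m\<close> of the positive elements. If \<open>m = 0\<close>, the multiples of small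
  elements are dense. If \<open>m > 0\<close>, then \<open>m\<close> is attained, since otherwise two distinct elements
  between \<open>m\<close> and \<open>2m\<close> would have a positive difference below \<open>m\<close>; division with remainder by \<open>m\<close>
  does the rest.
\<close>

lemma real_subgroup_discrete_or_dense:
  fixes H :: "real set"
  assumes sub: "\<And>x y. x \<in> H \<Longrightarrow> y \<in> H \<Longrightarrow> x - y \<in> H"
    and h: "h \<in> H" "h \<noteq> 0"
  shows "(\<exists>m>0. H = range (\<lambda>k. m * real_of_int k)) \<or> (\<forall>r. \<forall>e>0. \<exists>x\<in>H. \<bar>x - r\<bar> < e)"
proof -
  have zero: "0 \<in> H" using sub[OF h(1) h(1)] by simp
  have neg: "- x \<in> H" if "x \<in> H" for x using sub[OF zero that] by simp
  have add: "x + y \<in> H" if "x \<in> H" "y \<in> H" for x y using sub[OF that(1) neg[OF that(2)]] by simp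
  have mult_nat: "x * real k \<in> H" if "x \<in> H" for x k
    by (induction k) (auto simp: zero add that distrib_left)
  have mult: "x * of_int k \<in> H" if "x \<in> H" for x k
    using mult_nat[OF that, of "nat k"] neg[OF mult_nat[OF that, of "nat (- k)"]]
    by (cases "0 \<le> k") auto
  have near: "\<bar>x * of_int \<lfloor>y / x\<rfloor> - y\<bar> < x \<and> x * of_int \<lfloor>y / x\<rfloor> \<le> y" if "0 < x" for x y :: real
  proof -
    have "of_int \<lfloor>y / x\<rfloor> \<le> y / x" "y / x < of_int \<lfloor>y / x\<rfloor> + 1" by linarith+
    then have "of_int \<lfloor>y / x\<rfloor> * x \<le> y" "y < (of_int \<lfloor>y / x\<rfloor> + 1) * x"
      using that by (simp_all only: pos_le_divide_eq pos_divide_less_eq)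
    then have "x * of_int \<lfloor>y / x\<rfloor> \<le> y" "y < x * of_int \<lfloor>y / x\<rfloor> + x"
      by (simp_all add: algebra_simps)
    then show ?thesis by linarith
  qed
  define P where "P = {x \<in> H. 0 < x}"
  define m where "m = Inf P"
  have "\<bar>h\<bar> \<in> P" using h neg[OF h(1)] by (auto simp: P_def abs_if)
  then have ne: "P \<noteq> {}" by blast
  have bdd: "bdd_below P" by (auto simp: P_def intro: bdd_belowI[of _ 0])
  have m_le: "m \<le> x" if "x \<in> P" for x using that bdd by (simp add: m_def cInf_lower)
  have m_near: "\<exists>x\<in>P. x < y" if "m < y" for y
    using that ne bdd by (simp add: m_def cInf_less_iff)
  have "0 \<le> m" unfolding m_def using ne by (intro cInf_greatest) (auto simp: P_def)
  show ?thesis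
  proof (cases "m = 0")
    case True
    have "\<exists>x\<in>H. \<bar>x - r\<bar> < e" if e: "0 < e" for r e
    proof -
      obtain x where "x \<in> P" "x < e" using m_near[of e] True e by auto
      then have "\<bar>x * of_int \<lfloor>r / x\<rfloor> - r\<bar> < e" "x * of_int \<lfloor>r / x\<rfloor> \<in> H"
        using near[of x r] mult by (auto simp: P_def)
      then show ?thesis by blast
    qed
    then show ?thesis by blast
  next
    case False
    with \<open>0 \<le> m\<close> have m: "0 < m" by simp
    have "m \<in> P"
    proof (rule ccontr)
      assume "m \<notin> P"
      obtain x where x: "x \<in> P" "x < m + m" using m_near[of "m + m"] m by auto
      have "x \<noteq> m" using x(1) \<open>m \<notin> P\<close> by blast
      then have "m < x" using m_le[OF x(1)] by simp
      then obtain y where y: "y \<in> P" "y < x" using m_near by blast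
      then have "x - y \<in> P" using x(1) sub by (auto simp: P_def)
      then show False using m_le[of "x - y"] m_le[OF y(1)] x(2) by linarith
    qed
    then have mH: "m \<in> H" by (simp add: P_def)
    have "x \<in> range (\<lambda>k. m * real_of_int k)" if "x \<in> H" for x
    proof -
      let ?r = "x - m * of_int \<lfloor>x / m\<rfloor>"
      have "?r \<in> H" using sub[OF that mult[OF mH]] .
      moreover have "0 \<le> ?r" "?r < m" using near[OF m, of x] by linarith+
      ultimately have "?r = 0" using m_le[of ?r] unfolding P_def by (metis (mono_tags, lifting) mem_Collect_eq not_le order_le_imp_less_or_eq)
      then show ?thesis by (intro image_eqI[of _ _ "\<lfloor>x / m\<rfloor>"]) auto
    qed
    then have "H = range (\<lambda>k. m * real_of_int k)" using mult[OF mH] by auto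
    with m show ?thesis by blast
  qed
qed

text \<open>
  Preimages of a sequence that approximates \<open>r\<close> form a Cauchy sequence, whose limit is sent to \<open>r\<close>.
\<close>

lemma (in complete_normed_ab_group) surj_if_dense_isometry:
  assumes add: "\<And>g h. \<phi> (g + h) = \<phi> g + \<phi> h"
    and nrm: "\<And>g. \<bar>\<phi> g\<bar> = nrm g"
    and dense: "\<And>r e. 0 < e \<Longrightarrow> \<exists>g. \<bar>\<phi> g - r\<bar> < e"
  shows "surj \<phi>"
  unfolding surj_def
proof
  fix r
  have diff: "\<phi> (g - h) = \<phi> g - \<phi> h" for g h
    using add[of "g - h" h] by simp
  obtain \<sigma> where \<sigma>: "\<And>n. \<bar>\<phi> (\<sigma> n) - r\<bar> < inverse (real (Suc n))"
    using dense[of "inverse (real (Suc n))" r for n] by (metis inverse_positive_iff_positive of_nat_0_less_iff zero_less_Suc)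
  have lim: "(\<lambda>n. \<phi> (\<sigma> n)) \<longlonglongrightarrow> r"
  proof (rule LIM_zero_cancel, rule Lim_null_comparison)
    show "\<forall>\<^sub>F n in sequentially. norm (\<phi> (\<sigma> n) - r) \<le> inverse (real (Suc n))"
      using \<sigma> by (intro always_eventually allI) (simp add: less_imp_le del: of_nat_Suc)
  qed (rule LIMSEQ_inverse_real_of_nat)
  have "metric.MCauchy \<sigma>"
    unfolding metric.MCauchy_def
    using LIMSEQ_imp_Cauchy[OF lim] by (auto simp: Cauchy_def dist_real_def nrm[symmetric] diff)
  then obtain x where "limitin metric.mtopology \<sigma> x sequentially"
    using mcomplete unfolding metric.mcomplete_def by blast
  then have "\<forall>e>0. \<forall>\<^sub>F n in sequentially. nrm (\<sigma> n - x) < e"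
    by (simp add: metric.limitin_metric)
  then have "(\<lambda>n. \<phi> (\<sigma> n)) \<longlonglongrightarrow> \<phi> x"
    by (simp add: tendsto_iff dist_real_def nrm[symmetric] diff)
  then have "r = \<phi> x" using lim LIMSEQ_unique by blast
  then show "\<exists>x. r = \<phi> x" ..
qed

lemma (in complete_normed_ab_group) real_or_integers_if_embeds:
  assumes add: "\<And>g h. \<phi> (g + h) = \<phi> g + \<phi> h"
    and nrm: "\<And>g. \<bar>\<phi> g\<bar> = nrm g" and nontrivial: "\<exists>g::'a. g \<noteq> 0"
  shows "isometrically_isomorphic nrm (\<lambda>x::real. \<bar>x\<bar>) \<or>
    (\<exists>c>0. isometrically_isomorphic (\<lambda>g. c * nrm g) (\<lambda>k::int. real_of_int \<bar>k\<bar>))"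
proof -
  have diff: "\<phi> (g - h) = \<phi> g - \<phi> h" for g h
    using add[of "g - h" h] by simp
  have inj: "inj \<phi>"
    using nrm diff nrm_eq_0_iff by (metis abs_0 eq_iff_diff_eq_0 injI)
  obtain g :: 'a where "g \<noteq> 0" using nontrivial by blast
  then have g: "\<phi> g \<noteq> 0" using nrm[of g] nrm_pos[of g] by auto
  have "(\<exists>m>0. range \<phi> = range (\<lambda>k. m * real_of_int k)) \<or> (\<forall>r. \<forall>e>0. \<exists>x\<in>range \<phi>. \<bar>x - r\<bar> < e)"
    by (rule real_subgroup_discrete_or_dense[where h = "\<phi> g"]) (use g in \<open>auto simp: diff[symmetric]\<close>)
  then show ?thesis
  proof
    assume "\<forall>r. \<forall>e>0. \<exists>x\<in>range \<phi>. \<bar>x - r\<bar> < e"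
    then have "surj \<phi>" by (intro surj_if_dense_isometry add nrm) auto
    then show ?thesis
      unfolding isometrically_isomorphic_def using inj add nrm bij_def by blast
  next
    assume "\<exists>m>0. range \<phi> = range (\<lambda>k. m * real_of_int k)"
    then obtain m where m: "0 < m" and range: "range \<phi> = range (\<lambda>k. m * real_of_int k)" by blast
    define \<psi> where "\<psi> g = \<lfloor>\<phi> g / m\<rfloor>" for g
    have \<psi>: "\<phi> g = m * of_int (\<psi> g)" for g
    proof -
      obtain k where "\<phi> g = m * of_int k" using range by (metis rangeI imageE)
      then show ?thesis using m by (simp add: \<psi>_def)
    qed
    have "inj \<psi>" using inj \<psi> by (metis injD injI)
    moreover have "\<exists>g. \<psi> g = k" for k
    proof -
      obtain g where "\<phi> g = m * of_int k" using range by (metis rangeI imageE)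
      then have "\<psi> g = k" using m by (simp add: \<psi>_def)
      then show ?thesis ..
    qed
    ultimately have "bij \<psi>" by (metis bijI surjI)
    moreover have "\<psi> (g + h) = \<psi> g + \<psi> h" for g h
    proof -
      have "m * of_int (\<psi> (g + h)) = m * of_int (\<psi> g + \<psi> h)"
        using \<psi> add by (simp add: distrib_left)
      then show ?thesis using m by simp
    qed
    moreover have "real_of_int \<bar>\<psi> g\<bar> = 1 / m * nrm g" for g
      using m by (simp add: nrm[symmetric] \<psi>[of g] abs_mult)
    ultimately have "isometrically_isomorphic (\<lambda>g. 1 / m * nrm g) (\<lambda>k::int. real_of_int \<bar>k\<bar>)"
      unfolding isometrically_isomorphic_def by blast
    then show ?thesis using m by (metis zero_less_divide_1_iff)
  qed
qed

section \<open>Groups of exponent two\<close>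

context collinear_normed_group
begin

text \<open>
  Suppose that \<open>a, b, c\<close> are independent. On each of the seven lines \<open>{x, y, x + y}\<close> of the Fano plane
  that they span, one norm is the sum of the other two. This has no positive solution: if \<open>e\<close> has
  the largest norm \<open>M\<close>, then \<open>\<bar>x + e\<bar> = M - \<bar>x\<bar>\<close> for the other six points. Let \<open>x, y, e\<close> be
  independent. As \<open>x + y = (x + e) + (y + e)\<close>, the norm of \<open>x + y\<close> is either \<open>\<bar>\<bar>x\<bar> - \<bar>y\<bar>\<bar>\<close>, or
  it is both \<open>\<bar>x\<bar> + \<bar>y\<bar>\<close> and \<open>2M - \<bar>x\<bar> - \<bar>y\<bar>\<close> and hence \<open>M\<close>, which contradicts
  \<open>\<bar>x + y + e\<bar> > 0\<close>. Applied to \<open>x + e\<close> and \<open>y\<close>, this also gives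
  \<open>M - \<bar>x + y\<bar> = \<bar>x + y + e\<bar> = \<bar>M - \<bar>x\<bar> - \<bar>y\<bar>\<bar>\<close>, so that one of \<open>\<bar>x\<bar>\<close>, \<open>\<bar>y\<bar>\<close>,
  \<open>\<bar>x + e\<bar>\<close> and \<open>\<bar>y + e\<bar>\<close> vanishes.
\<close>

lemma exponent_two_at_most_four:
  fixes a b c :: 'a
  assumes two: "\<And>x::'a. x + x = 0"
    and "a \<noteq> 0" "b \<noteq> 0" "a \<noteq> b"
  shows "c \<in> {0, a, b, a + b}"
proof (rule ccontr)
  assume c: "c \<notin> {0, a, b, a + b}"
  have minus: "- x = x" for x :: 'a using two[of x] by (simp add: minus_unique)
  have zero: "x + y = 0 \<longleftrightarrow> x = y" for x y :: 'a using minus by (metis add_eq_0_iff)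
  have "a + b \<noteq> 0" "a + c \<noteq> 0" "b + c \<noteq> 0" "a + b + c \<noteq> 0" "c \<noteq> 0"
    using assms c zero[of a b] zero[of a c] zero[of b c] zero[of "a + b" c] by auto
  note pos = this[THEN nrm_pos] assms(2,3)[THEN nrm_pos]
  \<comment> \<open>Six of the lines are instances of collinearity as they stand; the line through \<open>a + b\<close>,
    \<open>a + c\<close> and \<open>b + c\<close> is one because \<open>2a = 0\<close>.\<close>
  have "(a + b) + (a + c) = b + c" "a + (b + c) = a + b + c" "b + (a + c) = a + b + c"
    using two[of a] by (simp_all add: algebra_simps)
  then show False
    using pos collinear[of a b] collinear[of a c] collinear[of b c]
      collinear[of a "b + c"] collinear[of b "a + c"] collinear[of "a + b" c]
      collinear[of "a + b" "a + c"]
    by (smt (verit))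
qed

end

context normed_ab_group
begin

lemma isomorphic_Z2:
  assumes "a \<noteq> 0" "\<And>x. x \<in> {0, a}" "a + a = 0"
  shows "isometrically_isomorphic (\<lambda>g. 1 / nrm a * nrm g) Z2_norm"
proof -
  define \<phi> where "\<phi> x = (if x = 0 then 0 else 1 :: bit)" for x :: 'a
  have "inj \<phi>" unfolding inj_def \<phi>_def using assms by (metis empty_iff insertE zero_neq_one)
  moreover have "surj \<phi>"
    unfolding surj_def \<phi>_def by (metis (full_types) assms(1) bit.exhaust)
  moreover have "\<phi> (x + y) = \<phi> x + \<phi> y" for x y
    using assms(2)[of x] assms(2)[of y] assms(1,3) by (auto simp: \<phi>_def)
  moreover have "Z2_norm (\<phi> x) = 1 / nrm a * nrm x" for x
    using assms(2)[of x] nrm_pos[OF assms(1)] assms(1) by (auto simp: \<phi>_def Z2_norm_def)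
  ultimately show ?thesis unfolding isometrically_isomorphic_def bij_def by blast
qed

lemma isomorphic_Z2xZ2:
  assumes two: "\<And>x::'a. x + x = 0"
    and ab: "a \<noteq> 0" "b \<noteq> 0" "a \<noteq> b" and all: "\<And>x. x \<in> {0, a, b, a + b}"
    and sum: "nrm (a + b) = nrm a + nrm b"
  shows "isometrically_isomorphic (\<lambda>g. 1 / nrm a * nrm g) (Z2xZ2_norm (nrm b / nrm a))"
proof -
  define \<phi> where "\<phi> x = (if x = a \<or> x = a + b then 1 else 0 :: bit,
    if x = b \<or> x = a + b then 1 else 0 :: bit)" for x
  have ab0: "a + b \<noteq> 0" using two[of a] ab by (metis add_left_cancel)
  have "a + (a + b) = b" "b + (a + b) = a" using two by (simp_all add: algebra_simps)
  note sums = this this[unfolded add.commute[of _ "a + b"]] two add.commute[of b a]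
  have "inj \<phi>"
  proof (rule injI)
    fix x y assume "\<phi> x = \<phi> y"
    then show "x = y"
      using all[of x] all[of y] ab ab0 by (auto simp: \<phi>_def split: if_splits)
  qed
  moreover have "\<exists>x. z = \<phi> x" for z
  proof -
    have "\<phi> 0 = (0, 0)" "\<phi> a = (1, 0)" "\<phi> b = (0, 1)" "\<phi> (a + b) = (1, 1)"
      using ab ab0 by (auto simp: \<phi>_def)
    then show ?thesis using bit_pair_cases[of z] by (metis empty_iff insert_iff)
  qed
  moreover have "\<phi> (x + y) = \<phi> x + \<phi> y" for x y
    using all[of x] all[of y] ab ab0 by (auto simp: \<phi>_def sums)
  moreover have "Z2xZ2_norm (nrm b / nrm a) (\<phi> x) = 1 / nrm a * nrm x" for x
    using all[of x] ab ab0 nrm_pos[OF ab(1)] sum by (auto simp: \<phi>_def Z2xZ2_norm_def add_divide_distrib)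
  ultimately show ?thesis unfolding isometrically_isomorphic_def bij_def surj_def by blast
qed

end

text \<open>
  In a group of four elements, the summands on the right of \<open>\<bar>x + y\<bar> = \<bar>x\<bar> + \<bar>y\<bar>\<close> are the generators,
  and the smaller norm is scaled to \<open>1\<close>.
\<close>

lemma (in collinear_normed_group) exponent_two_classification:
  fixes a :: 'a
  assumes two: "\<And>x::'a. x + x = 0" and a: "a \<noteq> 0"
  shows "\<exists>c>0. isometrically_isomorphic (\<lambda>g. c * nrm g) Z2_norm \<or>
    (\<exists>\<alpha>\<ge>1. isometrically_isomorphic (\<lambda>g. c * nrm g) (Z2xZ2_norm \<alpha>))"
proof (cases "\<forall>x. x \<in> {0, a}")
  case True
  then have "isometrically_isomorphic (\<lambda>g. 1 / nrm a * nrm g) Z2_norm"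
    using isomorphic_Z2[OF a] two by blast
  moreover have "0 < 1 / nrm a" using nrm_pos[OF a] by simp
  ultimately show ?thesis by blast
next
  case False
  then obtain b where b: "b \<noteq> 0" "a \<noteq> b" by blast
  have all: "x \<in> {0, a, b, a + b}" for x
    by (rule exponent_two_at_most_four[OF two a b])
  have ordered: ?thesis
    if h: "x \<noteq> 0" "y \<noteq> 0" "x \<noteq> y" "nrm x \<le> nrm y" "nrm (x + y) = nrm x + nrm y" for x y
  proof -
    have "z \<in> {0, x, y, x + y}" for z
      by (rule exponent_two_at_most_four[OF two h(1-3)])
    then have "isometrically_isomorphic (\<lambda>g. 1 / nrm x * nrm g) (Z2xZ2_norm (nrm y / nrm x))"
      using isomorphic_Z2xZ2[OF two h(1-3)] h(5) by blast
    moreover have "1 \<le> nrm y / nrm x" "0 < 1 / nrm x" using h nrm_pos[OF h(1)] by auto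
    ultimately show ?thesis by blast
  qed
  have summands: ?thesis
    if "x \<noteq> 0" "y \<noteq> 0" "x \<noteq> y" "nrm (x + y) = nrm x + nrm y" for x y
  proof -
    have "nrm (y + x) = nrm y + nrm x" using that(4) by (simp add: add.commute)
    from ordered[OF that(2,1) that(3)[symmetric] _ this] ordered[OF that(1-3) _ that(4)]
    show ?thesis using linear[of "nrm x" "nrm y"] by blast
  qed
  have sums: "a + (a + b) = b" "b + (a + b) = a" using two by (simp_all add: algebra_simps)
  have distinct: "a + b \<noteq> 0" "a \<noteq> a + b" "b \<noteq> a + b"
    using sums a b by (metis add_0_right, simp_all)
  have "nrm (a + b) = nrm a + nrm b \<or> nrm b = nrm a + nrm (a + b) \<or> nrm a = nrm b + nrm (a + b)"
    using collinear[of a b] by linarith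
  then show ?thesis
  proof (elim disjE)
    assume "nrm (a + b) = nrm a + nrm b"
    then show ?thesis by (rule summands[OF a b])
  next
    assume "nrm b = nrm a + nrm (a + b)"
    then show ?thesis using summands[OF a distinct(1,2)] unfolding sums by blast
  next
    assume "nrm a = nrm b + nrm (a + b)"
    then show ?thesis using summands[OF b(1) distinct(1,3)] unfolding sums by blast
  qed
qed

section \<open>The classification\<close>

theorem theorem1p9:
  fixes nrm :: "'a::ab_group_add \<Rightarrow> real"
  assumes "complete_normed_ab_group nrm"
    and "\<exists>g::'a. g \<noteq> 0"
  shows "has_acyclic_nonbranching_plans nrm \<longleftrightarrow>
    (\<exists>c>0.
       isometrically_isomorphic (\<lambda>g. c * nrm g) (\<lambda>x::real. \<bar>x\<bar>) \<or>
       isometrically_isomorphic (\<lambda>g. c * nrm g) (\<lambda>k::int. real_of_int \<bar>k\<bar>) \<or>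
       isometrically_isomorphic (\<lambda>g. c * nrm g) Z2_norm \<or>
       (\<exists>\<alpha>\<ge>1. isometrically_isomorphic (\<lambda>g. c * nrm g) (Z2xZ2_norm \<alpha>)))"
    (is "_ \<longleftrightarrow> ?R")
proof -
  interpret complete_normed_ab_group nrm by fact
  have "has_cancelling_pairs nrm \<longleftrightarrow> ?R"
  proof
    assume "has_cancelling_pairs nrm"
    then interpret collinear_normed_group nrm by (rule collinear_if_cancelling_pairs)
    obtain a :: 'a where a: "a \<noteq> 0" using assms(2) by blast
    show ?R
    proof (cases "\<forall>x::'a. x + x = 0")
      case True
      then show ?thesis using exponent_two_classification[OF _ a] by blast
    next
      case False
      then obtain b :: 'a where "b + b \<noteq> 0" by blast
      then interpret doubling_normed_group nrm
        by unfold_locales (rule doubling_if_not_exponent_two)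
      have "isometrically_isomorphic nrm (\<lambda>x::real. \<bar>x\<bar>) \<or>
          (\<exists>c>0. isometrically_isomorphic (\<lambda>g. c * nrm g) (\<lambda>k::int. real_of_int \<bar>k\<bar>))"
        by (rule real_or_integers_if_embeds[OF signed_add[OF a] abs_signed assms(2)])
      moreover have "isometrically_isomorphic nrm (\<lambda>x::real. \<bar>x\<bar>) \<longleftrightarrow>
          isometrically_isomorphic (\<lambda>g. 1 * nrm g) (\<lambda>x::real. \<bar>x\<bar>)" by simp
      ultimately show ?thesis using zero_less_one by blast
    qed
  next
    assume ?R
    then obtain c where c: "0 < c" and iso:
      "isometrically_isomorphic (\<lambda>g. c * nrm g) (\<lambda>x::real. \<bar>x\<bar>) \<or>
       isometrically_isomorphic (\<lambda>g. c * nrm g) (\<lambda>k::int. real_of_int \<bar>k\<bar>) \<or>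
       isometrically_isomorphic (\<lambda>g. c * nrm g) Z2_norm \<or>
       (\<exists>\<alpha>\<ge>1. isometrically_isomorphic (\<lambda>g. c * nrm g) (Z2xZ2_norm \<alpha>))" by blast
    then consider
        (real) "isometrically_isomorphic (\<lambda>g. c * nrm g) (\<lambda>x::real. \<bar>x\<bar>)"
      | (int) "isometrically_isomorphic (\<lambda>g. c * nrm g) (\<lambda>k::int. real_of_int \<bar>k\<bar>)"
      | (Z2) "isometrically_isomorphic (\<lambda>g. c * nrm g) Z2_norm"
      | (Klein) \<alpha> where "1 \<le> \<alpha>" "isometrically_isomorphic (\<lambda>g. c * nrm g) (Z2xZ2_norm \<alpha>)"
      by blast
    then show "has_cancelling_pairs nrm"
    proof cases
      case real
      then obtain \<phi> :: "'a \<Rightarrow> real" where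
        "\<And>g h. \<phi> (g + h) = \<phi> g + \<phi> h" "\<And>g. \<bar>\<phi> g\<bar> = c * nrm g"
        unfolding isometrically_isomorphic_def by blast
      then show ?thesis using cancelling_pairs_if_embeds_in_reals c by blast
    next
      case int
      then obtain \<phi> :: "'a \<Rightarrow> int" where
        "\<And>g h. \<phi> (g + h) = \<phi> g + \<phi> h" "\<And>g. real_of_int \<bar>\<phi> g\<bar> = c * nrm g"
        unfolding isometrically_isomorphic_def by blast
      then show ?thesis
        by (intro cancelling_pairs_if_embeds_in_reals[of "\<lambda>g. real_of_int (\<phi> g)" c] c) auto
    next
      case Z2
      then show ?thesis using cancelling_pairs_if_isomorphic c cancelling_pairs_Z2 by blast
    next
      case Klein
      then show ?thesis
        using cancelling_pairs_if_isomorphic c cancelling_pairs_Z2xZ2 by blast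
    qed
  qed
  then show ?thesis using plans_iff_cancelling_pairs by simp
qed

end
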